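(* The algorithm PA-II is convergent: for the error $E_n^k=U(T_n)-U_n^k$ and every $k\ge0$, $$\max_{1\le j\le N}\|E_j^{k+1}\|\le \alpha^{k+1}\min\left\{\left(\frac{1-\beta^{N-1}}{1-\beta}\right)^{k+1},\binom{N-1}{k+1}\right\}\max_{1\le j\le N}\|E_j^0\|,$$ where $\alpha=\|P_{J_2}-P_2\|$ and $\beta=\|P_2\|$.
   Context: Let $h>0$, let $N_x\ge 3$ be an integer, and let $D_h=\frac1{h^2}\,\mathrm{tridiag}(1,-2,1)\in\mathbb{R}^{(N_x-2)\times(N_x-2)}$ be the discrete Dirichlet Laplacian (diagonal entries $-2/h^2$, sub- and superdiagonal entries $1/h^2$, all others $0$). Let $\epsilon>0$, $T>0$, integers $N\ge1$ and $J\ge2$, $\Delta T=T/N$, $\Delta t=\Delta T/J$, $T_n=n\Delta T$. $\|\cdot\|$ is the Euclidean norm on $\mathbb{R}^{N_x-2}$ and the induced matrix norm. For $i\in\{1,2\}$ set $$P_i=(I-i\Delta T D_h+\epsilon^2\Delta T D_h^2)^{-1}(I-i\Delta T D_h),\qquad P_{J_i}=\Big[\big(I-\tfrac{i\Delta T}{J}D_h+\epsilon^2\tfrac{\Delta T}{J}D_h^2\big)^{-1}\big(I-\tfrac{i\Delta T}{J}D_h\big)\Big]^J .$$ Parareal iteration: given a fine propagator $\mathcal F$ and a coarse propagator $\mathcal G$ (maps $\mathbb{R}^{N_x-2}\to\mathbb{R}^{N_x-2}$ advancing the solution from $T_n$ to $T_{n+1}$) and $u^0\in\mathbb{R}^{N_x-2}$,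 the initial guess is $U_0^0=u^0$, $U_{n+1}^0=\mathcal G(U_n^0)$, and for $k=0,1,2,\dots$ $$U_0^{k+1}=u^0,\qquad U_{n+1}^{k+1}=\mathcal G(U_n^{k+1})+\mathcal F(U_n^k)-\mathcal G(U_n^k),\quad 0\le n\le N-1.$$ The discrete fine solution is $U(T_0)=u^0$, $U(T_{n+1})=\mathcal F(U(T_n))$. PA-II (in the form analyzed): the Parareal iteration with $\mathcal F(U)=P_{J_2}U$ and $\mathcal G(U)=P_2U$. These are the propagators of the linear convex-splitting scheme $\frac{W^{n+1}-W^n}{\Delta t}=D_h\,\mathrm{diag}(W^n)^2W^{n}-3D_hW^n-\epsilon^2D_h^2W^{n+1}+2D_hW^{n+1}$ for the Cahn-Hilliard equation, with $\mathrm{diag}(W^n)^2$ replaced by $I$; $\mathcal F$ takes $J$ steps of size $\Delta t$ and $\mathcal G$ one step of size $\Delta T$. Convention: $\binom{a}{b}=0$ if $b>a\ge 0$. *)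

theory Defs
  imports "HOL-Analysis.Analysis"
begin

text \<open>
  The grid points are indexed by a finite linearly ordered type \<open>'n\<close>; only their
  ordinal number matters, so that \<open>'n\<close> stands for \<open>{0, ..., CARD('n) - 1}\<close>.
\<close>

definition idx :: "'n::{finite,linorder} \<Rightarrow> nat" where
  "idx i = card {j. j < i}"

definition discrete_laplacian :: "real \<Rightarrow> real^'n::{finite,linorder}^'n::{finite,linorder}" where
  "discrete_laplacian h = (\<chi> i j.
     if idx i = idx j then - 2 / h^2
     else if idx i = Suc (idx j) \<or> idx j = Suc (idx i) then 1 / h^2
     else 0)"

text \<open>The library's \<open>*\<close> on \<open>real^'n^'n\<close> is componentwise, hence \<open>^\<close> is not the matrix power.\<close>

definition matrix_pow :: "real^'n::finite^'n::finite \<Rightarrow> nat \<Rightarrow> real^'n::finite^'n::finite" where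
  "matrix_pow A m = (((**) A) ^^ m) (mat 1)"

definition matrix_norm :: "real^'n::finite^'n::finite \<Rightarrow> real" where
  "matrix_norm A = onorm ((*v) A)"

text \<open>
  One step of size \<open>\<tau>\<close>, in terms of the parameter \<open>i\<close> of the family \<open>P\<^sub>i\<close>. For \<open>i = 2\<close>, solving
  \<open>(W' - W) / \<tau> = D W - 3 D W - \<epsilon>\<^sup>2 D\<^sup>2 W' + 2 D W'\<close> for \<open>W'\<close> gives \<open>W' = cs_step 2 h \<epsilon> \<tau> *v W\<close>.
\<close>

definition cs_step :: "nat \<Rightarrow> real \<Rightarrow> real \<Rightarrow> real \<Rightarrow> real^'n::{finite,linorder}^'n::{finite,linorder}" where
  "cs_step i h \<epsilon> \<tau> =
     (let D = discrete_laplacian h in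
      matrix_inv (mat 1 - (real i * \<tau>) *\<^sub>R D + (\<epsilon>^2 * \<tau>) *\<^sub>R (D ** D))
      ** (mat 1 - (real i * \<tau>) *\<^sub>R D))"

definition coarse_matrix :: "nat \<Rightarrow> real \<Rightarrow> real \<Rightarrow> real \<Rightarrow> real^'n::{finite,linorder}^'n::{finite,linorder}" where
  "coarse_matrix i h \<epsilon> \<Delta>T = cs_step i h \<epsilon> \<Delta>T"

definition fine_matrix :: "nat \<Rightarrow> real \<Rightarrow> real \<Rightarrow> real \<Rightarrow> nat \<Rightarrow> real^'n::{finite,linorder}^'n::{finite,linorder}" where
  "fine_matrix i h \<epsilon> \<Delta>T J = matrix_pow (cs_step i h \<epsilon> (\<Delta>T / real J)) J"

text \<open>\<open>parareal F G u0 k n\<close> is the iterate \<open>U\<^sub>n\<^sup>k\<close>.\<close>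

fun parareal ::
  "('a::ab_group_add \<Rightarrow> 'a) \<Rightarrow> ('a \<Rightarrow> 'a) \<Rightarrow> 'a \<Rightarrow> nat \<Rightarrow> nat \<Rightarrow> 'a" where
  "parareal F G u0 k 0 = u0"
| "parareal F G u0 0 (Suc n) = G (parareal F G u0 0 n)"
| "parareal F G u0 (Suc k) (Suc n) =
     G (parareal F G u0 (Suc k) n) + F (parareal F G u0 k n) - G (parareal F G u0 k n)"

definition fine_solution :: "('a \<Rightarrow> 'a) \<Rightarrow> 'a \<Rightarrow> nat \<Rightarrow> 'a" where
  "fine_solution F u0 n = (F ^^ n) u0"

definition pa2_fine :: "real \<Rightarrow> real \<Rightarrow> real \<Rightarrow> nat \<Rightarrow> nat \<Rightarrow> real^'n::{finite,linorder} \<Rightarrow> real^'n::{finite,linorder}" where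
  "pa2_fine h \<epsilon> T N J u = fine_matrix 2 h \<epsilon> (T / real N) J *v u"

definition pa2_coarse :: "real \<Rightarrow> real \<Rightarrow> real \<Rightarrow> nat \<Rightarrow> real^'n::{finite,linorder} \<Rightarrow> real^'n::{finite,linorder}" where
  "pa2_coarse h \<epsilon> T N u = coarse_matrix 2 h \<epsilon> (T / real N) *v u"

end

theory Submission
  imports Defs
begin

text \<open>
  Write \<open>A = mat 1 - 2\<tau>D + \<epsilon>\<^sup>2\<tau>D\<^sup>2\<close> and \<open>B = mat 1 - 2\<tau>D\<close>, so that the coarse propagator is
  \<open>A\<inverse>B\<close>, and the two propagators \<open>F\<close> and \<open>G\<close> are linear. Subtracting the Parareal update from the
  fine recursion gives \<open>E\<^bsub>n+1\<^esub>\<^bsup>k+1\<^esup> = G E\<^sub>n\<^bsup>k+1\<^esup> + (F - G) E\<^sub>n\<^bsup>k\<^esup>\<close> with \<open>E\<^sub>0\<^bsup>k\<^esup> = 0\<close>, so the error norms obey the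
  scalar inequality \<open>e (k+1) (n+1) \<le> \<beta> e (k+1) n + \<alpha> e k n\<close>.

  Solving this inequality in \<open>n\<close> for fixed \<open>k\<close> costs a factor \<open>\<alpha>\<close> times a geometric sum
  per iteration (\<open>geometric_bound\<close>). Replacing \<open>\<beta>\<close> by \<open>1\<close> turns it into Pascal's rule, which gives
  the binomial coefficient (\<open>binomial_bound\<close>). The latter vanishes once \<open>k \<ge> N\<close>, so the iteration
  terminates with the fine solution after \<open>N\<close> steps and in particular converges.

  Both bounds rest on \<open>\<beta> < 1\<close>: the closed form of the geometric sum needs \<open>\<beta> \<noteq> 1\<close>, and
  Pascal's rule needs \<open>\<beta> \<le> 1\<close>. This is a property of the scheme. Summation by
  parts shows that \<open>D\<close> is negative definite (\<open>laplacian_negative_definite\<close>), and an energy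
  identity then shows that \<open>A w = B v\<close> makes \<open>w\<close> strictly shorter than a nonzero \<open>v\<close>, for
  every step size (\<open>convex_splitting_contracts\<close>). By compactness of the unit sphere the norm is below \<open>1\<close>.
\<close>

section \<open>Scalar error recursion\<close>

lemma geometric_step:
  fixes e e' :: "nat \<Rightarrow> real"
  assumes e0: "e 0 = 0" and e'0: "e' 0 = 0"
    and rec: "\<And>n. e' (Suc n) \<le> \<beta> * e' n + \<alpha> * e n"
    and bnd: "\<And>n. n \<le> N \<Longrightarrow> e n \<le> M"
    and "0 \<le> \<alpha>" "0 \<le> \<beta>" and "Suc n \<le> N"
  shows "e' (Suc n) \<le> \<alpha> * (\<Sum>i<n. \<beta> ^ i) * M"
  using \<open>Suc n \<le> N\<close>
proof (induction n)
  case 0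
  then show ?case using rec[of 0] e0 e'0 by simp
next
  case (Suc n)
  have "e' (Suc (Suc n)) \<le> \<beta> * e' (Suc n) + \<alpha> * e (Suc n)" by (rule rec)
  also have "\<dots> \<le> \<beta> * (\<alpha> * (\<Sum>i<n. \<beta> ^ i) * M) + \<alpha> * M"
    using Suc bnd[of "Suc n"] \<open>0 \<le> \<alpha>\<close> \<open>0 \<le> \<beta>\<close> by (intro add_mono mult_left_mono) auto
  also have "\<dots> = \<alpha> * (\<Sum>i<Suc n. \<beta> ^ i) * M"
    unfolding sum.lessThan_Suc_shift by (simp add: sum_distrib_left algebra_simps)
  finally show ?case .
qed

text \<open>
  The sum stops at \<open>N - 1\<close> and not at \<open>N\<close>: since all errors vanish at time index \<open>0\<close>, the first
  step contributes nothing.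
\<close>

lemma geometric_bound:
  fixes e :: "nat \<Rightarrow> nat \<Rightarrow> real"
  assumes e0: "\<And>k. e k 0 = 0"
    and rec: "\<And>k n. e (Suc k) (Suc n) \<le> \<beta> * e (Suc k) n + \<alpha> * e k n"
    and bnd: "\<And>n. n \<le> N \<Longrightarrow> e 0 n \<le> M"
    and "0 \<le> \<alpha>" "0 \<le> \<beta>" "0 \<le> M" and "n \<le> N"
  shows "e k n \<le> \<alpha> ^ k * (\<Sum>i<N - 1. \<beta> ^ i) ^ k * M"
  using \<open>n \<le> N\<close>
proof (induction k arbitrary: n)
  case 0
  then show ?case using bnd by simp
next
  case (Suc k)
  let ?g = "\<lambda>n. \<Sum>i<n. \<beta> ^ i"
  let ?M = "\<alpha> ^ k * ?g (N - 1) ^ k * M"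
  have g: "0 \<le> ?g m" for m using \<open>0 \<le> \<beta>\<close> by (simp add: sum_nonneg)
  have M: "0 \<le> ?M" using g \<open>0 \<le> \<alpha>\<close> \<open>0 \<le> M\<close> by simp
  have "e (Suc k) n \<le> \<alpha> * ?g (N - 1) * ?M"
  proof (cases n)
    case 0
    then show ?thesis using e0 g M \<open>0 \<le> \<alpha>\<close> by simp
  next
    case (Suc m)
    have "e (Suc k) (Suc m) \<le> \<alpha> * ?g m * ?M"
      using Suc Suc.prems
      by (intro geometric_step[where e = "e k" and e' = "e (Suc k)" and N = N] e0 rec Suc.IH
          \<open>0 \<le> \<alpha>\<close> \<open>0 \<le> \<beta>\<close>) auto
    also have "\<dots> \<le> \<alpha> * ?g (N - 1) * ?M"
      using Suc Suc.prems M \<open>0 \<le> \<alpha>\<close> \<open>0 \<le> \<beta>\<close>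
      by (intro mult_right_mono mult_left_mono sum_mono2) auto
    finally show ?thesis using Suc by simp
  qed
  then show ?case by (simp add: algebra_simps)
qed

text \<open>
  For \<open>\<beta> \<le> 1\<close> the recursion is dominated by Pascal's rule
  \<open>(n choose (k + 1)) = (n - 1 choose (k + 1)) + (n - 1 choose k)\<close>.
\<close>

lemma binomial_bound:
  fixes e :: "nat \<Rightarrow> nat \<Rightarrow> real"
  assumes e0: "\<And>k. e k 0 = 0"
    and nonneg: "\<And>k n. 0 \<le> e k n"
    and rec: "\<And>k n. e (Suc k) (Suc n) \<le> \<beta> * e (Suc k) n + \<alpha> * e k n"
    and bnd: "\<And>n. n \<le> N \<Longrightarrow> e 0 n \<le> M"
    and "0 \<le> \<alpha>" "\<beta> \<le> 1" and "Suc n \<le> N"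
  shows "e k (Suc n) \<le> \<alpha> ^ k * real (n choose k) * M"
  using \<open>Suc n \<le> N\<close>
proof (induction n arbitrary: k)
  case 0
  then show ?case
    using bnd[of 1] rec[of _ 0] by (cases k) (auto simp: e0)
next
  case (Suc n)
  show ?case
  proof (cases k)
    case 0
    then show ?thesis using bnd Suc.prems by simp
  next
    case (Suc l)
    have "e (Suc l) (Suc (Suc n)) \<le> \<beta> * e (Suc l) (Suc n) + \<alpha> * e l (Suc n)" by (rule rec)
    also have "\<dots> \<le> 1 * e (Suc l) (Suc n) + \<alpha> * e l (Suc n)"
      using \<open>\<beta> \<le> 1\<close> nonneg by (intro add_mono mult_right_mono) auto
    also have "\<dots> \<le> 1 * (\<alpha> ^ Suc l * real (n choose Suc l) * M) + \<alpha> * (\<alpha> ^ l * real (n choose l) * M)"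
      using Suc.prems \<open>0 \<le> \<alpha>\<close> by (intro add_mono mult_left_mono Suc.IH order_refl) simp_all
    also have "\<dots> = \<alpha> ^ Suc l * real (Suc n choose Suc l) * M"
      by (simp add: algebra_simps)
    finally show ?thesis using Suc by simp
  qed
qed

section \<open>Errors of the Parareal iteration\<close>

lemma parareal_error_Suc:
  fixes F G :: "'a::real_vector \<Rightarrow> 'a"
  assumes "linear F" "linear G"
  shows "fine_solution F u0 (Suc n) - parareal F G u0 (Suc k) (Suc n)
    = G (fine_solution F u0 n - parareal F G u0 (Suc k) n)
      + (F (fine_solution F u0 n - parareal F G u0 k n) - G (fine_solution F u0 n - parareal F G u0 k n))"
  by (simp add: fine_solution_def linear_diff[OF assms(1)] linear_diff[OF assms(2)])

lemma matrix_norm_bound: "norm (A *v x) \<le> matrix_norm A * norm x"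
  unfolding matrix_norm_def by (simp add: onorm matrix_vector_mul_bounded_linear)

lemma matrix_norm_nonneg: "0 \<le> matrix_norm A"
  unfolding matrix_norm_def by (simp add: onorm_pos_le matrix_vector_mul_bounded_linear)

lemma parareal_error_bounds:
  fixes A B :: "real^'n^'n" and u0 :: "real^'n"
  defines "E \<equiv> \<lambda>k n. fine_solution ((*v) A) u0 n - parareal ((*v) A) ((*v) B) u0 k n"
  defines "\<alpha> \<equiv> matrix_norm (A - B)" and "\<beta> \<equiv> matrix_norm B"
  assumes bnd: "\<And>n. 1 \<le> n \<Longrightarrow> n \<le> N \<Longrightarrow> norm (E 0 n) \<le> M" and "\<beta> < 1" and "0 \<le> M"
    and n: "1 \<le> n" "n \<le> N"
  shows "norm (E k n)
    \<le> \<alpha> ^ k * min (((1 - \<beta> ^ (N - 1)) / (1 - \<beta>)) ^ k) (real ((N - 1) choose k)) * M"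
proof -
  have nonneg: "0 \<le> \<alpha>" "0 \<le> \<beta>" by (simp_all add: \<alpha>_def \<beta>_def matrix_norm_nonneg)
  have e0: "norm (E k 0) = 0" for k by (simp add: E_def fine_solution_def)
  have rec: "norm (E (Suc k) (Suc n)) \<le> \<beta> * norm (E (Suc k) n) + \<alpha> * norm (E k n)" for k n
  proof -
    have "E (Suc k) (Suc n) = B *v E (Suc k) n + (A - B) *v E k n"
      unfolding E_def
      by (subst parareal_error_Suc) (simp_all add: matrix_vector_mult_diff_rdistrib)
    then have "norm (E (Suc k) (Suc n)) \<le> norm (B *v E (Suc k) n) + norm ((A - B) *v E k n)"
      by (simp add: norm_triangle_ineq)
    then show ?thesis
      using matrix_norm_bound[of B "E (Suc k) n"] matrix_norm_bound[of "A - B" "E k n"]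
      unfolding \<alpha>_def \<beta>_def by linarith
  qed
  have bnd': "norm (E 0 n) \<le> M" if "n \<le> N" for n
    using that bnd[of n] e0[of 0] \<open>0 \<le> M\<close> by (cases "n = 0") auto
  have "norm (E k n) \<le> \<alpha> ^ k * (\<Sum>i<N - 1. \<beta> ^ i) ^ k * M"
    using n by (intro geometric_bound[where e = "\<lambda>k n. norm (E k n)"] e0 rec bnd' nonneg \<open>0 \<le> M\<close>)
  also have "(\<Sum>i<N - 1. \<beta> ^ i) = (1 - \<beta> ^ (N - 1)) / (1 - \<beta>)"
    using \<open>\<beta> < 1\<close> by (simp add: sum_gp_strict)
  finally have geo: "norm (E k n) \<le> \<alpha> ^ k * ((1 - \<beta> ^ (N - 1)) / (1 - \<beta>)) ^ k * M" .
  obtain m where m: "n = Suc m" using n by (cases n) auto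
  have "norm (E k (Suc m)) \<le> \<alpha> ^ k * real (m choose k) * M"
    using n m \<open>\<beta> < 1\<close>
    by (intro binomial_bound[where e = "\<lambda>k n. norm (E k n)" and N = N and \<beta> = \<beta>] e0 rec bnd' nonneg)
      auto
  also have "\<dots> \<le> \<alpha> ^ k * real ((N - 1) choose k) * M"
    using n m nonneg \<open>0 \<le> M\<close>
    by (intro mult_right_mono mult_left_mono) (auto intro!: binomial_right_mono)
  finally show ?thesis
    using geo m by (simp add: min_def)
qed

section \<open>The discrete Dirichlet Laplacian is negative definite\<close>

lemma idx_less_iff: "idx i < idx j \<longleftrightarrow> i < j"
proof -
  have *: "idx i < idx j" if "i < j" for i j :: 'a
    unfolding idx_def using that by (intro psubset_card_mono) auto
  show ?thesis using *[of i j] *[of j i] by (cases i j rule: linorder_cases) auto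
qed

lemma bij_betw_idx: "bij_betw (idx :: 'n::{finite,linorder} \<Rightarrow> nat) UNIV {..<CARD('n)}"
proof -
  have inj: "inj (idx :: 'n \<Rightarrow> nat)"
    by (rule injI) (metis idx_less_iff less_irrefl neqE)
  have "idx i < CARD('n)" for i :: 'n
    unfolding idx_def by (rule psubset_card_mono) auto
  then have "range (idx :: 'n \<Rightarrow> nat) \<subseteq> {..<CARD('n)}" by auto
  moreover have "card (range (idx :: 'n \<Rightarrow> nat)) = card {..<CARD('n)}"
    using inj by (simp add: card_image)
  ultimately show ?thesis
    using inj by (simp add: bij_betw_def card_subset_eq)
qed

text \<open>
  The Dirichlet extension places the entries of \<open>x\<close> at \<open>1, ..., CARD('n)\<close> with zero boundary
  values on both sides, so that every row of the Laplacian is the same second difference.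
\<close>

definition dirichlet_ext :: "real^'n::{finite,linorder} \<Rightarrow> nat \<Rightarrow> real" where
  "dirichlet_ext x k = (if 1 \<le> k \<and> k \<le> CARD('n) then x $ the_inv idx (k - 1) else 0)"

lemma dirichlet_ext_idx:
  fixes x :: "real^'a::{finite,linorder}"
  shows "dirichlet_ext x (Suc (idx i)) = x $ i"
proof -
  have "idx i < CARD('a)" using bij_betwE[OF bij_betw_idx] by auto
  moreover have "the_inv idx (idx i) = i"
    using bij_betw_idx by (auto simp: bij_betw_def intro!: the_inv_f_f)
  ultimately show ?thesis by (simp add: dirichlet_ext_def)
qed

lemma laplacian_row:
  fixes x :: "real^'n::{finite,linorder}"
  shows "(discrete_laplacian h *v x) $ i
    = (dirichlet_ext x (idx i) - 2 * dirichlet_ext x (Suc (idx i)) + dirichlet_ext x (Suc (Suc (idx i)))) / h^2"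
proof -
  let ?f = "dirichlet_ext x" and ?k = "idx i" and ?m = "CARD('n)"
  let ?c = "\<lambda>l. if ?k = l then - 2 / h^2 else if ?k = Suc l \<or> l = Suc ?k then 1 / h^2 else 0"
  have k: "?k < ?m" using bij_betwE[OF bij_betw_idx] by auto
  have "(discrete_laplacian h *v x) $ i = (\<Sum>j\<in>(UNIV :: 'n set). ?c (idx j) * ?f (Suc (idx j)))"
    by (simp add: matrix_vector_mult_def discrete_laplacian_def dirichlet_ext_idx)
  also have "\<dots> = (\<Sum>l<?m. ?c l * ?f (Suc l))"
    by (rule sum.reindex_bij_betw[OF bij_betw_idx])
  \<comment> \<open>Each row has one entry per diagonal. The first row has no left neighbour, but there
    \<open>?k - 1\<close> truncates to \<open>0\<close>, hence the inner case distinction.\<close>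
  also have "\<dots> = (\<Sum>l<?m. (if l = ?k then - 2 / h^2 * ?f (Suc l) else 0)
      + (if l = ?k - 1 then (if ?k = 0 then 0 else 1 / h^2 * ?f (Suc l)) else 0)
      + (if l = Suc ?k then 1 / h^2 * ?f (Suc l) else 0))"
    by (intro sum.cong) auto
  also have "\<dots> = (?f ?k - 2 * ?f (Suc ?k) + ?f (Suc (Suc ?k))) / h^2"
    using k by (auto simp: sum.distrib sum.delta dirichlet_ext_def add_divide_distrib diff_divide_distrib)
  finally show ?thesis .
qed

lemma summation_by_parts:
  fixes f :: "nat \<Rightarrow> real"
  shows "(\<Sum>k<m. f (Suc k) * (f k - 2 * f (Suc k) + f (Suc (Suc k))))
    = f m * (f (Suc m) - f m) - f 0 * (f 1 - f 0) - (\<Sum>k<m. (f (Suc k) - f k)^2)"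
  by (induction m) (simp_all add: algebra_simps power2_eq_square)

text \<open>
  With zero boundary values summation by parts turns the quadratic form of \<open>D\<close> into minus the
  sum of the squared differences. If it vanishes, all differences vanish, and the extension is
  constantly equal to its boundary value \<open>0\<close>.
\<close>

lemma laplacian_negative_definite:
  fixes x :: "real^'n::{finite,linorder}"
  assumes "h > 0" and "x \<noteq> 0"
  shows "x \<bullet> (discrete_laplacian h *v x) < 0"
proof -
  let ?f = "dirichlet_ext x" and ?m = "CARD('n)"
  let ?S = "\<Sum>k<Suc ?m. (?f (Suc k) - ?f k)^2"
  have f0: "?f 0 = 0" and fm: "?f (Suc ?m) = 0" by (simp_all add: dirichlet_ext_def)
  have "x \<bullet> (discrete_laplacian h *v x)
      = (\<Sum>i\<in>(UNIV :: 'n set). ?f (Suc (idx i)) * ((?f (idx i) - 2 * ?f (Suc (idx i)) + ?f (Suc (Suc (idx i)))) / h^2))"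
    by (simp add: inner_vec_def laplacian_row dirichlet_ext_idx)
  also have "\<dots> = (\<Sum>k<?m. ?f (Suc k) * ((?f k - 2 * ?f (Suc k) + ?f (Suc (Suc k))) / h^2))"
    by (rule sum.reindex_bij_betw[OF bij_betw_idx])
  also have "\<dots> = (\<Sum>k<?m. ?f (Suc k) * (?f k - 2 * ?f (Suc k) + ?f (Suc (Suc k)))) / h^2"
    by (simp add: sum_divide_distrib)
  also have "\<dots> = - ?S / h^2"
    unfolding summation_by_parts by (simp add: f0 fm power2_eq_square)
  finally have eq: "x \<bullet> (discrete_laplacian h *v x) = - ?S / h^2" .
  have "?S \<noteq> 0"
  proof
    assume "?S = 0"
    then have step: "?f (Suc k) = ?f k" if "k < Suc ?m" for k
      using that by (subst (asm) sum_nonneg_eq_0_iff) auto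
    have "?f k = 0" if "k \<le> Suc ?m" for k
      using that by (induction k) (auto simp: f0 step)
    moreover have "idx i < ?m" for i :: 'n using bij_betwE[OF bij_betw_idx] by auto
    ultimately have "x $ i = 0" for i
      using dirichlet_ext_idx[of x i] by (simp add: less_imp_le)
    then show False using \<open>x \<noteq> 0\<close> by (simp add: vec_eq_iff)
  qed
  moreover have "0 \<le> ?S" by (intro sum_nonneg) auto
  ultimately have "0 < ?S" by linarith
  then show ?thesis unfolding eq using \<open>h > 0\<close> by (simp add: divide_neg_pos)
qed

lemma laplacian_self_adjoint:
  "x \<bullet> (discrete_laplacian h *v y) = (discrete_laplacian h *v x) \<bullet> y"
proof -
  have "transpose (discrete_laplacian h) = discrete_laplacian h"
    by (auto simp: transpose_def discrete_laplacian_def vec_eq_iff)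
  then show ?thesis
    by (metis dot_lmul_matrix transpose_matrix_vector)
qed

section \<open>The convex-splitting step is a strict contraction\<close>

lemma matrix_inv_right:
  fixes A :: "real^'n^'n"
  assumes "invertible A"
  shows "A ** matrix_inv A = mat 1"
  using someI_ex[OF assms[unfolded invertible_def]] by (simp add: matrix_inv_def)

lemma invertible_if_form_positive:
  fixes A :: "real^'n^'n"
  assumes "\<And>x. x \<noteq> 0 \<Longrightarrow> 0 < x \<bullet> (A *v x)"
  shows "invertible A"
  unfolding invertible_left_inverse matrix_left_invertible_ker
  using assms by (metis inner_zero_right less_irrefl)

text \<open>
  With \<open>B = mat 1 - sD\<close>, choose \<open>z\<close> such that \<open>B z = D w\<close>. As \<open>B\<close> commutes with \<open>D\<close> and is
  injective, \<open>(B + cD\<^sup>2) w = B v\<close> amounts to \<open>v = w + c D z\<close>. In the expansion of the squared norm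
  of \<open>v\<close> the mixed term is \<open>2c (w \<bullet> D z) = 2c (B z \<bullet> z)\<close>, which is
  positive because \<open>D\<close> is negative definite and \<open>z\<close> cannot vanish unless \<open>v\<close> does.
\<close>

lemma convex_splitting_contracts:
  fixes D :: "real^'n^'n"
  assumes sym: "\<And>x y. x \<bullet> (D *v y) = (D *v x) \<bullet> y"
    and neg: "\<And>x. x \<noteq> 0 \<Longrightarrow> x \<bullet> (D *v x) < 0"
    and "0 \<le> s" "0 < c" and "v \<noteq> 0"
    and eq: "(mat 1 - s *\<^sub>R D + c *\<^sub>R (D ** D)) *v w = (mat 1 - s *\<^sub>R D) *v v"
  shows "norm w < norm v"
proof -
  let ?B = "mat 1 - s *\<^sub>R D"
  have B: "?B *v x = x - s *\<^sub>R (D *v x)" for x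
    by (simp add: matrix_vector_mult_diff_rdistrib scaleR_matrix_vector_assoc)
  have B_pos: "norm x ^ 2 \<le> x \<bullet> (?B *v x)" for x
    using neg[of x] \<open>0 \<le> s\<close>
    by (cases "x = 0") (auto simp: B inner_diff_right power2_norm_eq_inner mult_nonneg_nonpos)
  have "0 < x \<bullet> (?B *v x)" if "x \<noteq> 0" for x
    using B_pos[of x] that by (smt (verit) zero_less_norm_iff zero_less_power)
  then have inv: "invertible ?B" by (rule invertible_if_form_positive)
  then have B_inj: "x = y" if "?B *v x = ?B *v y" for x y
    using inv that
    by (metis invertible_left_inverse matrix_vector_mul_assoc matrix_vector_mul_lid)
  obtain z where z: "?B *v z = D *v w"
    using inv by (metis matrix_inv_right matrix_vector_mul_assoc matrix_vector_mul_lid)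
  have "?B *v v = ?B *v w + c *\<^sub>R (D *v (D *v w))"
    using eq by (simp add: matrix_vector_mult_add_rdistrib scaleR_matrix_vector_assoc
        matrix_vector_mul_assoc)
  also have "D *v (D *v w) = ?B *v (D *v z)"
    unfolding z[symmetric] B by (simp add: matrix_vector_mult_diff_distrib matrix_vector_mult_scaleR)
  also have "?B *v w + c *\<^sub>R (?B *v (D *v z)) = ?B *v (w + c *\<^sub>R (D *v z))"
    by (simp add: matrix_vector_right_distrib matrix_vector_mult_scaleR)
  finally have v: "v = w + c *\<^sub>R (D *v z)" by (rule B_inj)
  have "z \<noteq> 0"
  proof
    assume "z = 0"
    then have "D *v w = 0" using z by simp
    then have "w = 0" using neg[of w] by auto
    then show False using v \<open>z = 0\<close> \<open>v \<noteq> 0\<close> by simp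
  qed
  have "w \<bullet> (D *v z) = z \<bullet> (?B *v z)"
    unfolding z using sym[of w z] by (simp add: inner_commute)
  then have "0 < w \<bullet> (D *v z)"
    using B_pos[of z] \<open>z \<noteq> 0\<close> by (smt (verit) zero_less_norm_iff zero_less_power)
  then have "0 < 2 * c * (w \<bullet> (D *v z))" using \<open>0 < c\<close> by simp
  moreover have "norm v ^ 2 = norm w ^ 2 + 2 * c * (w \<bullet> (D *v z)) + norm (c *\<^sub>R (D *v z)) ^ 2"
    unfolding v power2_norm_eq_inner
    by (simp add: inner_add_left inner_add_right inner_commute)
  ultimately have "norm w ^ 2 < norm v ^ 2"
    by (smt (verit) zero_le_power2)
  then show ?thesis by (rule power_less_imp_less_base) simp
qed

lemma matrix_norm_less_1:
  fixes A :: "real^'n^'n"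
  assumes "\<And>v. v \<noteq> 0 \<Longrightarrow> norm (A *v v) < norm v"
  shows "matrix_norm A < 1"
proof -
  have "sphere (0 :: real^'n) 1 \<noteq> {}" by simp
  moreover have "continuous_on (sphere 0 1) (\<lambda>v. norm (A *v v))"
    by (intro continuous_intros matrix_vector_mult_linear_continuous_on)
  ultimately obtain v where v: "v \<in> sphere 0 1"
    and max: "\<And>x. x \<in> sphere 0 1 \<Longrightarrow> norm (A *v x) \<le> norm (A *v v)"
    using continuous_attains_sup[of "sphere 0 1" "\<lambda>v. norm (A *v v)"] by auto
  have "norm (A *v x) \<le> norm (A *v v) * norm x" for x
  proof (cases "x = 0")
    case False
    have "norm (A *v (x /\<^sub>R norm x)) \<le> norm (A *v v)" using False by (intro max) simp
    then show ?thesis using False by (simp add: matrix_vector_mult_scaleR field_simps)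
  qed simp
  then have "matrix_norm A \<le> norm (A *v v)"
    unfolding matrix_norm_def by (intro onorm_le) (simp add: mult.commute)
  also have "\<dots> < 1" using v assms[of v] by force
  finally show ?thesis .
qed

lemma cs_step_norm_less_1:
  assumes "h > 0" "\<epsilon> > 0" "\<tau> > 0"
  shows "matrix_norm (cs_step i h \<epsilon> \<tau> :: real^'n::{finite,linorder}^'n::{finite,linorder}) < 1"
proof (rule matrix_norm_less_1)
  fix v :: "real^'n::{finite,linorder}" assume "v \<noteq> 0"
  let ?D = "discrete_laplacian h :: real^'n::{finite,linorder}^'n::{finite,linorder}"
  let ?s = "real i * \<tau>" and ?c = "\<epsilon>^2 * \<tau>"
  let ?A = "mat 1 - ?s *\<^sub>R ?D + ?c *\<^sub>R (?D ** ?D)"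
  have c: "0 < ?c" and s: "0 \<le> ?s" using assms by simp_all
  have "0 < x \<bullet> (?A *v x)" if "x \<noteq> 0" for x
  proof -
    have "x \<bullet> (?A *v x) = x \<bullet> x - ?s * (x \<bullet> (?D *v x)) + ?c * (x \<bullet> (?D *v (?D *v x)))"
      by (simp add: matrix_vector_mult_add_rdistrib matrix_vector_mult_diff_rdistrib
          scaleR_matrix_vector_assoc[symmetric] matrix_vector_mul_assoc inner_add_right inner_diff_right)
    also have "x \<bullet> (?D *v (?D *v x)) = (?D *v x) \<bullet> (?D *v x)" by (rule laplacian_self_adjoint)
    finally have "x \<bullet> (?A *v x) = x \<bullet> x - ?s * (x \<bullet> (?D *v x)) + ?c * ((?D *v x) \<bullet> (?D *v x))" .
    moreover have "?s * (x \<bullet> (?D *v x)) \<le> 0"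
      using s laplacian_negative_definite[OF \<open>h > 0\<close> that] by (simp add: mult_nonneg_nonpos)
    moreover have "0 \<le> ?c * ((?D *v x) \<bullet> (?D *v x))" using c by simp
    moreover have "0 < x \<bullet> x" using that by simp
    ultimately show ?thesis by linarith
  qed
  then have "invertible ?A" by (rule invertible_if_form_positive)
  then have "?A ** matrix_inv ?A = mat 1" by (rule matrix_inv_right)
  then have "?A *v (cs_step i h \<epsilon> \<tau> *v v) = (mat 1 - ?s *\<^sub>R ?D) *v v"
    by (simp add: cs_step_def Let_def matrix_vector_mul_assoc matrix_mul_assoc)
  then show "norm (cs_step i h \<epsilon> \<tau> *v v) < norm v"
    using laplacian_self_adjoint laplacian_negative_definite[OF \<open>h > 0\<close>] s c \<open>v \<noteq> 0\<close>
    by (intro convex_splitting_contracts[where D = ?D])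
qed

section \<open>Convergence of PA-II\<close>

theorem theorem3p9:
  fixes h \<epsilon> T \<Delta>T \<alpha> \<beta> :: real
    and Nx N J :: nat
    and P2 PJ2 :: "real^'n::{finite,linorder}^'n::{finite,linorder}"
    and u0 :: "real^'n::{finite,linorder}"
    and U :: "nat \<Rightarrow> nat \<Rightarrow> real^'n::{finite,linorder}"
    and Ufine :: "nat \<Rightarrow> real^'n::{finite,linorder}"
    and E :: "nat \<Rightarrow> nat \<Rightarrow> real^'n::{finite,linorder}"
  assumes "h > 0" and "\<epsilon> > 0" and "T > 0"
    and "Nx \<ge> 3" and "CARD('n) = Nx - 2"
    and "N \<ge> 1" and "J \<ge> 2"
    and "\<Delta>T = T / real N"
    and "P2 = coarse_matrix 2 h \<epsilon> \<Delta>T"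
    and "PJ2 = fine_matrix 2 h \<epsilon> \<Delta>T J"
    and "U = parareal (pa2_fine h \<epsilon> T N J) (pa2_coarse h \<epsilon> T N) u0"
    and "Ufine = fine_solution (pa2_fine h \<epsilon> T N J) u0"
    and "E = (\<lambda>k n. Ufine n - U k n)"
    and "\<alpha> = matrix_norm (PJ2 - P2)"
    and "\<beta> = matrix_norm P2"
  shows "(\<forall>n\<le>N. (\<lambda>k. U k n) \<longlonglongrightarrow> Ufine n) \<and>
    (\<forall>k. (MAX j\<in>{1..N}. norm (E (k + 1) j))
       \<le> \<alpha> ^ (k + 1)
         * min (((1 - \<beta> ^ (N - 1)) / (1 - \<beta>)) ^ (k + 1)) (real ((N - 1) choose (k + 1)))
         * (MAX j\<in>{1..N}. norm (E 0 j)))"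
proof -
  define M where "M = (MAX j\<in>{1..N}. norm (E 0 j))"
  have F: "pa2_fine h \<epsilon> T N J = (*v) PJ2" and G: "pa2_coarse h \<epsilon> T N = (*v) P2"
    using assms by (auto simp: pa2_fine_def pa2_coarse_def fun_eq_iff)
  have E: "E k n = fine_solution ((*v) PJ2) u0 n - parareal ((*v) PJ2) ((*v) P2) u0 k n" for k n
    using assms(11-13) F G by simp
  have "\<Delta>T > 0" using assms by simp
  then have \<beta>: "\<beta> < 1"
    unfolding assms(9,15) coarse_matrix_def
    using \<open>h > 0\<close> \<open>\<epsilon> > 0\<close> by (intro cs_step_norm_less_1)
  have M: "norm (E 0 n) \<le> M" if "1 \<le> n" "n \<le> N" for n
    unfolding M_def using that by (intro Max_ge) auto
  have "0 \<le> M" using M[of 1] \<open>N \<ge> 1\<close> by (smt (verit) norm_ge_zero le_refl)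
  have bound: "norm (E k n)
      \<le> \<alpha> ^ k * min (((1 - \<beta> ^ (N - 1)) / (1 - \<beta>)) ^ k) (real ((N - 1) choose k)) * M"
    if "1 \<le> n" "n \<le> N" for k n
    using parareal_error_bounds[of N PJ2 u0 P2 M n k] M \<beta> \<open>0 \<le> M\<close> that
    unfolding E assms(14,15) by blast
  have exact: "U k n = Ufine n" if "n \<le> N" "N \<le> k" for k n
  proof (cases "n = 0")
    case True
    then show ?thesis using assms(11,12) by (simp add: fine_solution_def)
  next
    case False
    have "0 \<le> (1 - \<beta> ^ (N - 1)) / (1 - \<beta>)"
      using \<beta> matrix_norm_nonneg[of P2] assms(15) by (simp add: power_le_one)
    moreover have "(N - 1) choose k = 0"
      using \<open>N \<ge> 1\<close> that by (simp add: binomial_eq_0)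
    ultimately have "min (((1 - \<beta> ^ (N - 1)) / (1 - \<beta>)) ^ k) (real ((N - 1) choose k)) = 0"
      by (metis min_absorb2 of_nat_0 zero_le_power)
    then have "norm (E k n) \<le> 0"
      using bound[of n k] False that by simp
    then have "E k n = 0" by simp
    then show ?thesis unfolding assms(13) by simp
  qed
  have "(\<lambda>k. U k n) \<longlonglongrightarrow> Ufine n" if "n \<le> N" for n
    using exact[OF that] by (intro tendsto_eventually eventually_sequentiallyI[of N]) auto
  moreover have "(MAX j\<in>{1..N}. norm (E (k + 1) j))
       \<le> \<alpha> ^ (k + 1)
         * min (((1 - \<beta> ^ (N - 1)) / (1 - \<beta>)) ^ (k + 1)) (real ((N - 1) choose (k + 1))) * M" for k
  proof (rule Max.boundedI)
    fix y assume "y \<in> (\<lambda>j. norm (E (k + 1) j)) ` {1..N}"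
    then obtain j where "y = norm (E (k + 1) j)" "1 \<le> j" "j \<le> N" by auto
    then show "y \<le> \<alpha> ^ (k + 1)
         * min (((1 - \<beta> ^ (N - 1)) / (1 - \<beta>)) ^ (k + 1)) (real ((N - 1) choose (k + 1))) * M"
      using bound by blast
  qed (use \<open>N \<ge> 1\<close> in auto)
  ultimately show ?thesis unfolding M_def by blast
qed

end
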